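(* Let $n\ge 3$ and $s\ge 1$ be integers. If $s$ is even, then $\operatorname{Ssat}(u_s,n)\ge n\lfloor\frac{s}{2}\rfloor+1$. If $s$ is odd, then $\operatorname{Ssat}(u_s,n)\ge n\lfloor\frac{s}{2}\rfloor+3$.
   Context: Sequences are finite words over an alphabet; a sequence on a given alphabet takes its letters from that alphabet (not every letter is required to appear). Two sequences are isomorphic if one is obtained from the other by a one-to-one renaming of letters. A copy of $u$ in a sequence is a (not necessarily contiguous) subsequence isomorphic to $u$. A sequence is $2$-sparse if no two adjacent letters are equal. For an integer $s\ge 0$, $u_s=xyxy\dots$ is the alternating sequence on two distinct letters $x,y$ of length $s+2$. A sequence on a given alphabet is $u_s$-semisaturated if it is $2$-sparse and inserting any letter of the alphabet at any position (including the beginning or the end) violates $2$-sparsity or creates a new copy of $u_s$, i.e. a copy that uses the inserted occurrence; the sequence itself need not avoid $u_s$. $\operatorname{Ssat}(u_s,n)$ is the minimum possible length of a $u_s$-semisaturated sequence on an alphabet of size $n$. *)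

theory Defs
  imports Main
begin

definition isomorphic_seq :: "'a list \<Rightarrow> 'b list \<Rightarrow> bool" where
  "isomorphic_seq u v \<longleftrightarrow> (\<exists>f. inj_on f (set u) \<and> v = map f u)"

text \<open>A copy is identified by the set \<open>I\<close> of positions (counted from 0) that it occupies,
  so that one can say which occurrences of letters a copy uses.\<close>

definition copy_at :: "'a list \<Rightarrow> 'b list \<Rightarrow> nat set \<Rightarrow> bool" where
  "copy_at u w I \<longleftrightarrow> I \<subseteq> {..<length w} \<and> isomorphic_seq u (nths w I)"

text \<open>The alternating sequence 0101\<open>\<dots>\<close> of length \<open>s + 2\<close>.\<close>

definition alt_seq :: "nat \<Rightarrow> nat list" where
  "alt_seq s = map (\<lambda>i. i mod 2) [0..<s + 2]"

text \<open>The inserted occurrence has position \<open>p\<close> in the new sequence; \<open>p = 0\<close> and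
  \<open>p = length w\<close> are insertion at the beginning and at the end.\<close>

definition insert_at :: "nat \<Rightarrow> 'a \<Rightarrow> 'a list \<Rightarrow> 'a list" where
  "insert_at p a w = take p w @ a # drop p w"

text \<open>2-sparsity is \<^const>\<open>distinct_adj\<close>.\<close>

definition semisaturated :: "nat \<Rightarrow> 'a set \<Rightarrow> 'a list \<Rightarrow> bool" where
  "semisaturated s A w \<longleftrightarrow>
     set w \<subseteq> A \<and> distinct_adj w \<and>
     (\<forall>a\<in>A. \<forall>p\<le>length w.
        \<not> distinct_adj (insert_at p a w) \<or>
        (\<exists>I. p \<in> I \<and> copy_at (alt_seq s) (insert_at p a w) I))"

text \<open>Letters are natural numbers. The value is unspecified if no semisaturated sequence
  exists, so a lower bound on it includes the existence of one.\<close>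

definition Ssat :: "nat \<Rightarrow> nat \<Rightarrow> nat" where
  "Ssat s n =
     (LEAST l. \<exists>(A :: nat set) w. finite A \<and> card A = n \<and> semisaturated s A w \<and> length w = l)"

end

theory Submission
  imports Defs "HOL-Library.Sublist"
begin

text \<open>
  Let \<open>k = s div 2\<close>. In \<open>u\<^sub>s\<close>, which has length \<open>s + 2\<close>, the first letter occurs
  \<open>(s + 3) div 2\<close> times and the other letter \<open>(s + 2) div 2 = k + 1\<close> times. If an inserted
  letter \<open>a\<close> completes a copy of \<open>u\<^sub>s\<close>, then the old word \<open>w\<close> contains all but one of the
  occurrences of \<open>a\<close> that the copy needs, and all occurrences of some other letter \<open>c\<close> that it
  needs (\<open>new_copy_counts\<close>). Every bound comes from choosing the insertion well.

  The most useful insertion is at the beginning of \<open>w\<close>, legal for every letter except \<open>hd w\<close>: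
  the inserted letter must then play the role of the first letter of \<open>u\<^sub>s\<close>, so it occurs at
  least \<open>(s + 3) div 2 - 1\<close> times in \<open>w\<close>. The letter \<open>h = hd w\<close> either fits into some gap of
  \<open>w\<close>, or touches every gap; in the latter case \<open>h\<close> occurs more often than all the other
  letters together (\<open>free_gap_or_majority\<close>). In both cases \<open>h\<close> occurs at least \<open>k\<close> times.

  If \<open>s\<close> is even, all letters thus occur at least \<open>k\<close> times, and the other letter of any new copy
  occurs at least \<open>k + 1\<close> times, which gives \<open>n k + 1\<close>. If \<open>s\<close> is odd, all letters except possibly \<open>h\<close>
  occur at least \<open>k + 1\<close> times; and if \<open>h\<close> occurs only \<open>k\<close> times, then it fits into some gap and
  plays the second role in the new copy that it creates there, so some other letter occurs at
  least \<open>k + 2\<close> times and makes up for it.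
  This gives \<open>n (k + 1)\<close>, which is at least \<open>n k + 3\<close> because \<open>n \<ge> 3\<close>.

  Since \<^const>\<open>Ssat\<close> is a least element, a bound on it also needs a semisaturated word to
  exist. The periodic word \<open>0 1 \<dots> (n-1) 0 1 \<dots> (n-1) \<dots>\<close> is one when it is long: at every gap,
  the part on one side is long enough to contain every word of length \<open>s + 1\<close>, in particular
  one that the inserted letter completes to a copy of \<open>u\<^sub>s\<close>.
\<close>

section \<open>Copies through an inserted letter\<close>

lemma count_list_subseq_le: "subseq u v \<Longrightarrow> count_list u x \<le> count_list v x"
  by (induction rule: list_emb.induct) auto

text \<open>Cutting at the inserted letter replaces sets of positions by two subsequences of the old
  word, one on each side of the gap.\<close>

lemma nths_through_insertion_iff:
  assumes "p \<le> length w"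
  shows "(\<exists>I. p \<in> I \<and> I \<subseteq> {..<length (insert_at p a w)} \<and> nths (insert_at p a w) I = v) \<longleftrightarrow>
    (\<exists>v1 v2. v = v1 @ a # v2 \<and> subseq v1 (take p w) \<and> subseq v2 (drop p w))"
    (is "?L \<longleftrightarrow> ?R")
proof -
  have len: "length (take p w) = p" using assms by simp
  have cut_at_p: "nths (insert_at p a w) I =
      nths (take p w) I @ a # nths (drop p w) {j. Suc j + p \<in> I}" if "p \<in> I" for I
    using that by (simp add: insert_at_def nths_append nths_Cons len del: length_take)
  show ?thesis
  proof
    assume ?L
    then obtain I where I: "p \<in> I" "nths (insert_at p a w) I = v" by blast
    then have "v = nths (take p w) I @ a # nths (drop p w) {j. Suc j + p \<in> I}"
      using cut_at_p by simp
    then show ?R unfolding subseq_conv_nths by blast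
  next
    assume ?R
    then obtain M N where v: "v = nths (take p w) M @ a # nths (drop p w) N"
      by (auto simp: subseq_conv_nths)
    have cut: "nths xs J = nths xs (J \<inter> {..<length xs})" for xs :: "'a list" and J
      unfolding nths_def by (auto intro!: arg_cong[of _ _ "map fst"] filter_cong dest: set_zip_rightD)
    define I where "I = {i. (i < p \<and> i \<in> M) \<or> i = p \<or> (p < i \<and> i \<le> length w \<and> i - Suc p \<in> N)}"
    have "nths (take p w) I = nths (take p w) M"
    proof -
      have "I \<inter> {..<length (take p w)} = M \<inter> {..<length (take p w)}"
        using assms by (auto simp: I_def)
      then show ?thesis by (metis cut)
    qed
    moreover have "nths (drop p w) {j. Suc j + p \<in> I} = nths (drop p w) N"
    proof -
      have "{j. Suc j + p \<in> I} \<inter> {..<length (drop p w)} = N \<inter> {..<length (drop p w)}"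
        using assms by (auto simp: I_def)
      then show ?thesis by (metis cut)
    qed
    moreover have "p \<in> I" by (simp add: I_def)
    ultimately have "nths (insert_at p a w) I = v"
      using v cut_at_p by simp
    moreover have "I \<subseteq> {..<length (insert_at p a w)}"
      using assms by (auto simp: I_def insert_at_def)
    ultimately show ?L using \<open>p \<in> I\<close> by blast
  qed
qed

lemma new_copy_iff:
  assumes "p \<le> length w"
  shows "(\<exists>I. p \<in> I \<and> copy_at u (insert_at p a w) I) \<longleftrightarrow>
    (\<exists>f v1 v2. inj_on f (set u) \<and> map f u = v1 @ a # v2 \<and>
       subseq v1 (take p w) \<and> subseq v2 (drop p w))"
proof -
  have "(\<exists>I. p \<in> I \<and> copy_at u (insert_at p a w) I) \<longleftrightarrow>
    (\<exists>f. inj_on f (set u) \<and>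
      (\<exists>I. p \<in> I \<and> I \<subseteq> {..<length (insert_at p a w)} \<and> nths (insert_at p a w) I = map f u))"
    unfolding copy_at_def isomorphic_seq_def by blast
  then show ?thesis unfolding nths_through_insertion_iff[OF assms] by blast
qed

section \<open>Letter counts forced by a new copy\<close>

lemma set_alt_seq: "set (alt_seq s) = {0, 1}"
proof -
  have "alt_seq s = 0 # 1 # map (\<lambda>i. i mod 2) [2..<s + 2]"
    by (simp add: alt_seq_def upt_conv_Cons numeral_2_eq_2 del: upt_Suc)
  then show ?thesis by auto
qed

lemma count_alt_seq:
  "count_list (alt_seq s) 0 = (s + 3) div 2"
  "count_list (alt_seq s) 1 = (s + 2) div 2"
proof -
  have "count_list (map (\<lambda>i. i mod 2) [0..<m]) 0 = (m + 1) div 2 \<and>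
        count_list (map (\<lambda>i. i mod 2) [0..<m]) 1 = m div 2" for m :: nat
    by (induction m) (auto, presburger+)
  from this[of "s + 2"] show "count_list (alt_seq s) 0 = (s + 3) div 2"
    "count_list (alt_seq s) 1 = (s + 2) div 2"
    by (simp_all add: alt_seq_def add.assoc del: upt_Suc)
qed

lemma alt_seq_eq_Cons: "alt_seq s = 0 # map (\<lambda>i. i mod 2) [1..<s + 2]"
  by (simp add: alt_seq_def upt_conv_Cons del: upt_Suc)

text \<open>The two disjuncts are the two roles that the inserted letter can play in the copy; at the
  beginning of the word, only the role of the first letter of the alternation is possible.\<close>

lemma new_copy_counts:
  assumes "p \<le> length w" "p \<in> I" "copy_at (alt_seq s) (insert_at p a w) I"
  obtains c where "c \<noteq> a"
    "(s + 3) div 2 \<le> count_list w a + 1 \<and> (s + 2) div 2 \<le> count_list w c \<or>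
     p > 0 \<and> (s + 2) div 2 \<le> count_list w a + 1 \<and> (s + 3) div 2 \<le> count_list w c"
proof -
  obtain f v1 v2 where f: "inj_on f (set (alt_seq s))" "map f (alt_seq s) = v1 @ a # v2"
    "subseq v1 (take p w)" "subseq v2 (drop p w)"
    using new_copy_iff[OF assms(1)] assms(2,3) by metis
  have "subseq (v1 @ v2) (take p w @ drop p w)"
    using f(3,4) by (rule list_emb_append_mono)
  then have le: "count_list v1 x + count_list v2 x \<le> count_list w x" for x
    using count_list_subseq_le[of "v1 @ v2" w x] by simp
  have count: "count_list v1 x + count_list v2 x + (if x = a then 1 else 0)
      = count_list (map f (alt_seq s)) x" for x
    by (simp add: f(2))
  have cnt0: "count_list (map f (alt_seq s)) (f 0) = (s + 3) div 2"
    using count_list_inj_map[OF f(1), of 0] by (simp add: set_alt_seq count_alt_seq)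
  have cnt1: "count_list (map f (alt_seq s)) (f 1) = (s + 2) div 2"
    using count_list_inj_map[OF f(1), of 1] count_alt_seq(2)[of s] by (simp add: set_alt_seq)
  have neq: "f 0 \<noteq> f 1" using f(1) by (auto simp: set_alt_seq inj_on_def)
  have "a \<in> set (map f (alt_seq s))" using f(2) by simp
  then consider "a = f 0" | "a = f 1" by (auto simp: set_alt_seq)
  then show thesis
  proof cases
    case 1
    then show thesis
      using le[of a] le[of "f 1"] count[of a] count[of "f 1"] cnt0 cnt1 neq
      by (intro that[of "f 1"]) auto
  next
    case 2
    have "p > 0"
    proof (rule ccontr)
      assume "\<not> p > 0"
      then have "v1 = []" using f(3) by simp
      then show False using f(2) 2 neq by (simp add: alt_seq_eq_Cons)
    qed
    with 2 show thesis
      using le[of a] le[of "f 0"] count[of a] count[of "f 0"] cnt0 cnt1 neq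
      by (intro that[of "f 0"]) auto
  qed
qed

text \<open>A letter that touches every gap is the first and the last letter and every other one in
  between, which is why it has the strict majority.\<close>

lemma free_gap_or_majority:
  assumes "distinct_adj w"
  shows "(\<exists>p\<le>length w. distinct_adj (insert_at p h w)) \<or> length w + 1 \<le> 2 * count_list w h"
  using assms
proof (induction w rule: induct_list012)
  case 1
  then show ?case by (simp add: insert_at_def)
next
  case (2 x)
  then show ?case by (cases "x = h") (auto simp: insert_at_def intro: exI[of _ 0])
next
  case (3 x y ws)
  show ?case
  proof (cases "x = h")
    case False
    then show ?thesis using 3 by (auto simp: insert_at_def intro!: exI[of _ 0])
  next
    case True
    have d: "distinct_adj ws" "x \<noteq> y" "ws = [] \<or> y \<noteq> hd ws"
      using 3(3) by (auto simp: distinct_adj_Cons)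
    from 3(1)[OF d(1)] show ?thesis
    proof
      assume "\<exists>p\<le>length ws. distinct_adj (insert_at p h ws)"
      then obtain p where p: "p \<le> length ws" "distinct_adj (insert_at p h ws)" by blast
      have "hd (insert_at p h ws) \<noteq> y"
        using p d True by (cases p; cases ws) (auto simp: insert_at_def)
      then have "distinct_adj (insert_at (Suc (Suc p)) h (x # y # ws))"
        using p d by (auto simp: insert_at_def distinct_adj_Cons)
      then show ?thesis using p by (intro disjI1 exI[of _ "Suc (Suc p)"]) auto
    next
      assume "length ws + 1 \<le> 2 * count_list ws h"
      then show ?thesis using True by simp
    qed
  qed
qed

section \<open>The lower bounds\<close>

context
  fixes s :: nat and A :: "'a set" and w :: "'a list"
  assumes semi: "semisaturated s A w" and fin: "finite A"
begin

lemma length_eq_sum_counts: "length w = (\<Sum>x\<in>A. count_list w x)"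
  using semi fin by (simp add: semisaturated_def sum_count_set)

lemma insertion_counts:
  assumes "a \<in> A" "p \<le> length w" "distinct_adj (insert_at p a w)"
  obtains c where "c \<in> A" "c \<noteq> a"
    "(s + 3) div 2 \<le> count_list w a + 1 \<and> (s + 2) div 2 \<le> count_list w c \<or>
     p > 0 \<and> (s + 2) div 2 \<le> count_list w a + 1 \<and> (s + 3) div 2 \<le> count_list w c"
proof -
  obtain I where "p \<in> I" "copy_at (alt_seq s) (insert_at p a w) I"
    using semi assms unfolding semisaturated_def by blast
  from new_copy_counts[OF assms(2) this] obtain c where c: "c \<noteq> a"
    "(s + 3) div 2 \<le> count_list w a + 1 \<and> (s + 2) div 2 \<le> count_list w c \<or>
     p > 0 \<and> (s + 2) div 2 \<le> count_list w a + 1 \<and> (s + 3) div 2 \<le> count_list w c"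
    by blast
  then have "count_list w c \<noteq> 0" by auto
  then have "c \<in> A" using semi by (auto simp: count_list_0_iff semisaturated_def)
  with c show thesis using that by blast
qed

text \<open>For empty \<open>w\<close> the letter \<open>hd w\<close> is unspecified, but then the insertion of any letter is
  legal.\<close>

lemma front_insertion_counts:
  assumes "a \<in> A" "a \<noteq> hd w"
  obtains c where "c \<in> A" "c \<noteq> a"
    "(s + 3) div 2 \<le> count_list w a + 1" "(s + 2) div 2 \<le> count_list w c"
proof -
  have "distinct_adj (insert_at 0 a w)"
    using semi assms(2) by (auto simp: insert_at_def semisaturated_def distinct_adj_Cons)
  from insertion_counts[OF assms(1) _ this] show thesis using that by auto
qed

text \<open>The alternative is that \<open>h\<close> has the strict majority, hence beats any single other letter,
  and the front insertion bounds the count of that letter.\<close>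

lemma legal_insertion_or_frequent:
  assumes "h \<in> A" "b \<in> A" "b \<noteq> h" "b \<noteq> hd w"
  shows "(\<exists>p\<le>length w. distinct_adj (insert_at p h w)) \<or> (s + 3) div 2 \<le> count_list w h"
proof -
  have "(s + 3) div 2 \<le> count_list w h" if "length w + 1 \<le> 2 * count_list w h"
  proof -
    have "count_list w b \<le> (\<Sum>x\<in>A - {h}. count_list w x)"
      using assms fin by (intro member_le_sum) auto
    moreover have "length w = count_list w h + (\<Sum>x\<in>A - {h}. count_list w x)"
      using sum.remove[OF fin assms(1), of "count_list w"] length_eq_sum_counts by simp
    moreover have "(s + 3) div 2 \<le> count_list w b + 1"
      using front_insertion_counts[OF assms(2,4)] by blast
    ultimately show ?thesis using that by linarith
  qed
  moreover have "distinct_adj w" using semi by (simp add: semisaturated_def)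
  ultimately show ?thesis using free_gap_or_majority[of w h] by blast
qed

lemma obtain_other_letter:
  assumes "card A \<ge> 3"
  obtains b where "b \<in> A" "b \<noteq> x" "b \<noteq> y"
proof -
  have "card {x, y} \<le> 2" by (simp add: card_insert_if)
  then have "\<not> A \<subseteq> {x, y}"
    using assms card_mono[of "{x, y}" A] by auto
  then show thesis using that by blast
qed

lemma count_ge_half:
  assumes "card A \<ge> 3" "h \<in> A"
  shows "s div 2 \<le> count_list w h"
proof -
  obtain b where b: "b \<in> A" "b \<noteq> h" "b \<noteq> hd w" using obtain_other_letter[OF assms(1)] .
  from legal_insertion_or_frequent[OF assms(2) b] show ?thesis
  proof
    assume "\<exists>p\<le>length w. distinct_adj (insert_at p h w)"
    then obtain p where "p \<le> length w" "distinct_adj (insert_at p h w)" by blast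
    then have "(s + 2) div 2 \<le> count_list w h + 1"
      by (rule insertion_counts[OF assms(2)]) linarith
    then show ?thesis by simp
  qed linarith
qed

lemma length_semisaturated_ge:
  assumes "card A \<ge> 3"
  shows "card A * (s div 2) + 1 \<le> length w"
proof -
  obtain b where b: "b \<in> A" "b \<noteq> hd w" using obtain_other_letter[OF assms] .
  then obtain c where c: "c \<in> A" "(s + 2) div 2 \<le> count_list w c"
    using front_insertion_counts by blast
  have "card (A - {c}) * (s div 2) \<le> (\<Sum>x\<in>A - {c}. count_list w x)"
    using sum_bounded_below[of "A - {c}" "s div 2" "count_list w"] count_ge_half[OF assms] by simp
  moreover have "card A = Suc (card (A - {c}))" using card.remove[OF fin c(1)] .
  ultimately show ?thesis
    using c(2) sum.remove[OF fin c(1), of "count_list w"] length_eq_sum_counts by simp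
qed

text \<open>At most one letter, namely \<open>hd w\<close>, can occur fewer than \<open>s div 2 + 1\<close> times, and then only
  one time fewer; the surplus of the letter that it alternates with in a new copy compensates
  for that.\<close>

lemma length_semisaturated_odd_ge:
  assumes "card A \<ge> 3" "odd s"
  shows "card A * (s div 2 + 1) \<le> length w"
proof -
  define k where "k = s div 2"
  have k: "(s + 3) div 2 = k + 2" "(s + 2) div 2 = k + 1"
    using \<open>odd s\<close> unfolding k_def by presburger+
  have others: "k + 1 \<le> count_list w a" if "a \<in> A" "a \<noteq> hd w" for a
    by (rule front_insertion_counts[OF that]) (use k in linarith)
  show ?thesis
  proof (cases "\<forall>a\<in>A. k + 1 \<le> count_list w a")
    case True
    then show ?thesis
      using sum_bounded_below[of A "k + 1" "count_list w"] length_eq_sum_counts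
      by (simp add: k_def)
  next
    case False
    then obtain h where h: "h \<in> A" "count_list w h < k + 1" by (meson not_le)
    obtain b where b: "b \<in> A" "b \<noteq> h" "b \<noteq> hd w" using obtain_other_letter[OF assms(1)] .
    obtain p where p: "p \<le> length w" "distinct_adj (insert_at p h w)"
      using legal_insertion_or_frequent[OF h(1) b] h(2) k by auto
    \<comment> \<open>The letter \<open>h\<close> is too rare to be the first letter of the alternation.\<close>
    obtain c where c: "c \<in> A" "c \<noteq> h" "k + 2 \<le> count_list w c"
      by (rule insertion_counts[OF h(1) p]) (use h(2) k in auto)
    have c': "finite (A - {h})" "c \<in> A - {h}" using c fin by auto
    have "h = hd w" using others[OF h(1)] h(2) by auto
    have "card (A - {h} - {c}) * (k + 1) \<le> (\<Sum>x\<in>A - {h} - {c}. count_list w x)"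
      using sum_bounded_below[of "A - {h} - {c}" "k + 1" "count_list w"] others \<open>h = hd w\<close>
      by simp
    moreover have "k \<le> count_list w h" using count_ge_half[OF assms(1) h(1)] by (simp add: k_def)
    moreover have "card A = card (A - {h} - {c}) + 2"
      using card.remove[OF fin h(1)] card.remove[OF c'] by linarith
    moreover have "length w = count_list w h + (count_list w c
        + (\<Sum>x\<in>A - {h} - {c}. count_list w x))"
      using sum.remove[OF fin h(1), of "count_list w"] sum.remove[OF c', of "count_list w"]
        length_eq_sum_counts by linarith
    ultimately show ?thesis using c(3) unfolding k_def[symmetric] by (simp add: algebra_simps)
  qed
qed

end

section \<open>Existence of semisaturated words\<close>

text \<open>Each letter of \<open>v\<close> is found within the next \<open>n\<close> letters of the periodic word.\<close>

lemma subseq_periodic: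
  assumes "set v \<subseteq> {..<n}" "p + n * length v \<le> m"
  shows "subseq v (map (\<lambda>i. i mod n) [p..<m])"
  using assms
proof (induction v arbitrary: p)
  case Nil
  then show ?case by simp
next
  case (Cons x v)
  \<comment> \<open>The first position from \<open>p\<close> on that carries the letter \<open>x\<close>.\<close>
  define i where "i = p + (x + n - p mod n) mod n"
  have n: "x < n" "0 < n" using Cons.prems by auto
  have "i mod n = (p mod n + (x + n - p mod n)) mod n"
    unfolding i_def by (simp add: mod_simps)
  also have "p mod n + (x + n - p mod n) = x + n"
    using mod_less_divisor[OF n(2), of p] by simp
  finally have im: "i mod n = x" using n by simp
  have i: "p \<le> i" "i < p + n" using n by (auto simp: i_def)
  then have "Suc i + n * length v \<le> m" using Cons.prems by simp
  then have "subseq v (map (\<lambda>i. i mod n) [Suc i..<m])" using Cons by simp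
  moreover have "[p..<m] = [p..<i] @ i # [Suc i..<m]"
    using i \<open>Suc i + n * length v \<le> m\<close>
    by (metis add_leD1 le_add_diff_inverse less_eq_Suc_le order.strict_implies_order
        upt_add_eq_append upt_conv_Cons)
  ultimately show ?case using im by (simp add: list_emb_append2)
qed

lemma mod_Suc_neq: "2 \<le> n \<Longrightarrow> i mod n \<noteq> Suc i mod n" for n :: nat
  by (simp add: mod_Suc)

text \<open>With \<open>2 * n * (s + 1)\<close> letters, every gap has at least \<open>n * (s + 1)\<close> letters on one side,
  enough for the \<open>s + 1\<close> letters of a copy besides the inserted one. The inserted letter is then
  the last or the first letter of the copy.\<close>

lemma semisaturated_periodic:
  assumes "2 \<le> n"
  shows "semisaturated s {..<n} (map (\<lambda>i. i mod n) [0..<2 * (n * (s + 1))])"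
proof -
  define m where "m = n * (s + 1)"
  define w where "w = map (\<lambda>i. i mod n) [0..<2 * m]"
  have "set w \<subseteq> {..<n}" using assms by (auto simp: w_def)
  moreover have "distinct_adj w"
    using assms mod_Suc_neq by (auto simp: w_def distinct_adj_conv_nth)
  moreover have "\<exists>I. p \<in> I \<and> copy_at (alt_seq s) (insert_at p a w) I"
    if a: "a < n" and p: "p \<le> length w" for a p
  proof -
    define b where "b = (if a = 0 then 1 else 0 :: nat)"
    have b: "b < n" "b \<noteq> a" using assms by (auto simp: b_def)
    have fits: "inj_on f (set (alt_seq s)) \<and> set (map f (alt_seq s)) \<subseteq> {..<n}"
      if "f = (\<lambda>i. if i = j then a else b)" "j \<in> {0, 1}" for f and j :: nat
      using that a b by (auto simp: inj_on_def set_alt_seq)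
    have len: "length (alt_seq s) = s + 2" by (simp add: alt_seq_def)
    show ?thesis
    proof (cases "m \<le> p")
      case True
      define j where "j = last (alt_seq s)"
      define f where "f = (\<lambda>i. if i = j then a else b)"
      have "j \<in> {0, 1}"
        unfolding j_def using set_alt_seq last_in_set[of "alt_seq s"] len by fastforce
      note f = fits[OF f_def this]
      have alt: "alt_seq s = butlast (alt_seq s) @ [j]"
        using len by (simp add: j_def alt_seq_eq_Cons)
      then have map: "map f (alt_seq s) = map f (butlast (alt_seq s)) @ [a]"
        by (metis f_def list.map(1,2) map_append)
      have "set (map f (butlast (alt_seq s))) \<subseteq> {..<n}" using f map by simp
      then have "subseq (map f (butlast (alt_seq s))) (map (\<lambda>i. i mod n) [0..<p])"
        using True len by (intro subseq_periodic) (auto simp: m_def)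
      moreover have "take p w = map (\<lambda>i. i mod n) [0..<p]"
        using p by (simp add: w_def take_map)
      ultimately show ?thesis
        unfolding new_copy_iff[OF p] using f map by (metis list_emb_Nil)
    next
      case False
      define f where "f = (\<lambda>i :: nat. if i = 0 then a else b)"
      note f = fits[OF f_def]
      define v where "v = map f (map (\<lambda>i. i mod 2) [1..<s + 2])"
      have map: "map f (alt_seq s) = [] @ a # v"
        unfolding alt_seq_eq_Cons v_def by (simp add: f_def del: upt_Suc)
      have "set v \<subseteq> {..<n}" using f map by simp
      then have "subseq v (map (\<lambda>i. i mod n) [p..<2 * m])"
        using False by (intro subseq_periodic) (auto simp: m_def v_def)
      moreover have "drop p w = map (\<lambda>i. i mod n) [p..<2 * m]"
        by (simp add: w_def drop_map)
      ultimately show ?thesis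
        unfolding new_copy_iff[OF p] using f map by (metis insertI1 list_emb_Nil)
    qed
  qed
  ultimately show ?thesis by (simp add: semisaturated_def w_def m_def)
qed

lemma Ssat_attained:
  assumes "2 \<le> n"
  obtains A :: "nat set" and w where
    "finite A" "card A = n" "semisaturated s A w" "length w = Ssat s n"
proof -
  define P where "P l \<longleftrightarrow> (\<exists>(A :: nat set) w.
    finite A \<and> card A = n \<and> semisaturated s A w \<and> length w = l)" for l
  have "P (length (map (\<lambda>i. i mod n) [0..<2 * (n * (s + 1))]))"
    unfolding P_def using semisaturated_periodic[OF assms] card_lessThan finite_lessThan by blast
  then have "P (LEAST l. P l)" by (rule LeastI)
  then show thesis using that unfolding P_def Ssat_def by blast
qed

theorem lemma4p9:
  fixes n s :: nat
  assumes "n \<ge> 3" and "s \<ge> 1"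
  shows "(even s \<longrightarrow> Ssat s n \<ge> n * (s div 2) + 1) \<and>
         (odd s \<longrightarrow> Ssat s n \<ge> n * (s div 2) + 3)"
proof -
  obtain A :: "nat set" and w where w: "finite A" "card A = n" "semisaturated s A w"
    "length w = Ssat s n"
    using Ssat_attained[of n s] assms(1) by auto
  have "n * (s div 2) + 1 \<le> Ssat s n"
    using length_semisaturated_ge[OF w(3,1)] w assms(1) by simp
  moreover have "n * (s div 2) + 3 \<le> Ssat s n" if "odd s"
    using length_semisaturated_odd_ge[OF w(3,1)] w assms(1) that by simp
  ultimately show ?thesis by blast
qed

end
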